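(* Let $g=g_1+g_2$ on $\mathbb{R}^n$, where $g_1:\mathbb{R}^n\to\mathbb{R}\cup\{+\infty\}$ is a proper, closed and $\mu_g$-strongly convex function ($\mu_g>0$) and $g_2:\mathbb{R}^n\to\mathbb{R}$ is convex with $L_{g_2}$-Lipschitz continuous gradient. Let $B\in\mathbb{R}^{p\times n}$, $b\in\mathbb{R}^p$, and suppose the set $\Omega$ of saddle points of $\mathcal{L}(y,\lambda)=g(y)+\langle\lambda,By-b\rangle$ is nonempty. Let $\{y_k\}_{k\ge1}$ be generated by Algorithm 4 (described in the context) with parameters $\beta,\gamma>0$, and let $(y^*,\lambda^* )\in\Omega$. Assume $\beta\le\frac{t_1^2}{L_{g_2}+t_1^2\gamma\|B\|^2}$ and that $\{t_k\}_{k\ge1}\subseteq[1,+\infty)$ is a nondecreasing sequence satisfying, for all $k\ge1$, $$t_{k+1}^2\le t_k^2+t_{k+1}\quad\text{and}\quad t_{k+1}^2\le t_k^2+\beta\mu_gt_k.$$ Then for all $k\ge1$: $$\|By_k-b\|\le\frac{C_4}{t_k^2},\qquad |g(y_k)-g(y^* )|\le\frac{\mathcal{E}_1+C_4\|\lambda^*\|}{t_k^2},$$ where $$\mathcal{E}_1=t_1^2\big(g(y_1)-g(y^* )+\langle\lambda^*,By_1-b\rangle\big)+\frac{t_2^2}{2\beta}\|y_1-y^*\|^2+\frac{1}{2\gamma}\|\lambda_1-\lambda^*\|^2,$$ $$C_4=3t_1^2\|By_1-b\|+\frac{2\|\lambda_1-\lambda^*\|+2\sqrt{2\gamma\mathc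al{E}_1}}{\gamma}.$$
   Context: Norms are Euclidean (operator norm for matrices). $dom(F)=\{x: F(x)<+\infty\}$; $F$ is proper if $dom(F)\ne\emptyset$; $F$ is closed if $F(x)\le\liminf_{y\to x}F(y)$ for all $x$ and $dom(F)$ is closed. $1/0$ is read as $+\infty$ in step-size bounds. $\mu_g$-strong convexity of $g_1$ means $g_1(y_2)-g_1(y_1)-\langle\xi,y_2-y_1\rangle\ge\frac{\mu_g}{2}\|y_2-y_1\|^2$ for all $y_1,y_2$ and $\xi\in\partial g_1(y_1)$. A saddle point is a pair $(y^*,\lambda^* )$ with $\mathcal{L}(y^*,\lambda)\le\mathcal{L}(y^*,\lambda^* )\le\mathcal{L}(y,\lambda^* )$ for all $(y,\lambda)$. The proximal operator is $\mathbf{Prox}_{s,h}(z)=\arg\min_x h(x)+\frac{1}{2s}\|x-z\|^2$. Algorithm 4 (for $\min g(y)$ s.t. $By=b$). Initialize $y_1=y_0=v_1\in dom(g)$, $\lambda_1\in\mathbb{R}^p$. For $k=1,2,\dots$: - $\bar y_k=y_k+\frac{t_k-1}{t_{k+1}}(y_k-y_{k-1})$; - $\bar\lambda_{k+1}=\lambda_k+\gamma t_{k+1}(Bv_k-b)$; - $\eta_k=\frac{\beta}{t_{k+1}^2+\beta\mu_g(t_{k+1}-1)}$; - $y_{k+1}=\mathbf{Prox}_{\eta_k,g_1}\big(\bar y_k-\eta_k(\mu_g(t_{k+1}-1)(\bar y_k-y_k)+B^T\bar\lambda_{k+1}+\nabla g_2(\bar y_k))\big)$; - $v_{k+1}=y_{k+1}+(t_{k+1}-1)(y_{k+1}-y_k)$;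 - $\lambda_{k+1}=\lambda_k+\gamma t_{k+1}(Bv_{k+1}-b)$. *)

theory Defs
  imports "HOL-Analysis.Analysis"
begin

definition ext_dom :: "('a \<Rightarrow> ereal) \<Rightarrow> 'a set" where
  "ext_dom F = {x. F x < \<infinity>}"

definition proper_fun :: "('a \<Rightarrow> ereal) \<Rightarrow> bool" where
  "proper_fun F \<longleftrightarrow> ext_dom F \<noteq> {}"

definition closed_fun :: "('a::topological_space \<Rightarrow> ereal) \<Rightarrow> bool" where
  "closed_fun F \<longleftrightarrow> (\<forall>x. F x \<le> Liminf (at x) F) \<and> closed (ext_dom F)"

text \<open>Intended for functions that do not take the value \<open>-\<infinity>\<close>, so that the sum on the right never
  has the form \<open>\<infinity> - \<infinity>\<close>.\<close>

definition ext_convex :: "('a::real_vector \<Rightarrow> ereal) \<Rightarrow> bool" where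
  "ext_convex F \<longleftrightarrow> (\<forall>x y. \<forall>u\<ge>0. \<forall>v\<ge>0. u + v = 1 \<longrightarrow>
     F (u *\<^sub>R x + v *\<^sub>R y) \<le> ereal u * F x + ereal v * F y)"

definition subdifferential :: "('a::real_inner \<Rightarrow> ereal) \<Rightarrow> 'a \<Rightarrow> 'a set" where
  "subdifferential F x = {\<xi>. x \<in> ext_dom F \<and> (\<forall>y. F x + ereal (\<xi> \<bullet> (y - x)) \<le> F y)}"

text \<open>Convexity is part of the notion: a nonconvex function may have no subgradients at all, and then
  the subgradient inequality alone would hold vacuously.\<close>

definition strongly_convex_fun :: "real \<Rightarrow> ('a::real_inner \<Rightarrow> ereal) \<Rightarrow> bool" where
  "strongly_convex_fun \<mu> F \<longleftrightarrow> ext_convex F \<and>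
     (\<forall>y1 y2. \<forall>\<xi>\<in>subdifferential F y1.
        F y2 - F y1 - ereal (\<xi> \<bullet> (y2 - y1)) \<ge> ereal (\<mu> / 2 * (norm (y2 - y1))\<^sup>2))"

definition prox :: "real \<Rightarrow> ('a::real_normed_vector \<Rightarrow> ereal) \<Rightarrow> 'a \<Rightarrow> 'a" where
  "prox s h z = (ARG_MIN (\<lambda>x. h x + ereal (1 / (2 * s) * (norm (x - z))\<^sup>2)) x. True)"

definition lagrangian ::
  "(real^'n \<Rightarrow> ereal) \<Rightarrow> real^'n^'p \<Rightarrow> real^'p \<Rightarrow> real^'n \<Rightarrow> real^'p \<Rightarrow> ereal" where
  "lagrangian g B b y l = g y + ereal (l \<bullet> (B *v y - b))"

definition saddle_points ::
  "(real^'n \<Rightarrow> ereal) \<Rightarrow> real^'n^'p \<Rightarrow> real^'p \<Rightarrow> ((real^'n) \<times> (real^'p)) set" where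
  "saddle_points g B b = {(ys, ls). \<forall>y l.
     lagrangian g B b ys l \<le> lagrangian g B b ys ls \<and>
     lagrangian g B b ys ls \<le> lagrangian g B b y ls}"

text \<open>The accelerated primal-dual iteration for minimizing \<open>g1 + g2\<close> subject to \<open>B y = b\<close>, where
  \<open>grad\<close> is the gradient of \<open>g2\<close>. The entries \<open>t 0\<close>, \<open>v 0\<close> and \<open>lam 0\<close> are never used.\<close>

definition generated_by_algorithm ::
  "(real^'n \<Rightarrow> ereal) \<Rightarrow> (real^'n \<Rightarrow> real^'n) \<Rightarrow> real^'n^'p \<Rightarrow> real^'p \<Rightarrow> real \<Rightarrow> real \<Rightarrow> real \<Rightarrow>
   (nat \<Rightarrow> real) \<Rightarrow> (nat \<Rightarrow> real^'n) \<Rightarrow> (nat \<Rightarrow> real^'n) \<Rightarrow> (nat \<Rightarrow> real^'p) \<Rightarrow> bool" where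
  "generated_by_algorithm g1 grad B b \<mu> \<beta> \<gamma> t y v lam \<longleftrightarrow>
     y 1 = y 0 \<and> v 1 = y 0 \<and> y 0 \<in> ext_dom g1 \<and>
     (\<forall>k\<ge>1.
        let ybar = y k + ((t k - 1) / t (k + 1)) *\<^sub>R (y k - y (k - 1));
            lambar = lam k + (\<gamma> * t (k + 1)) *\<^sub>R (B *v v k - b);
            \<eta> = \<beta> / ((t (k + 1))\<^sup>2 + \<beta> * \<mu> * (t (k + 1) - 1))
        in y (k + 1) = prox \<eta> g1
             (ybar - \<eta> *\<^sub>R ((\<mu> * (t (k + 1) - 1)) *\<^sub>R (ybar - y k)
                            + transpose B *v lambar + grad ybar)) \<and>
           v (k + 1) = y (k + 1) + (t (k + 1) - 1) *\<^sub>R (y (k + 1) - y k) \<and>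
           lam (k + 1) = lam k + (\<gamma> * t (k + 1)) *\<^sub>R (B *v v (k + 1) - b))"

end

theory Submission
  imports Defs
begin

text \<open>
  Write \<open>r\<^sub>k = B y\<^sub>k - b\<close> and let \<open>\<Delta>\<^sub>k \<ge> 0\<close> be the gap of the Lagrangian at \<open>(y\<^sub>k, \<lambda>\<^sup>*)\<close>. The energy
  \<open>t\<^sub>k\<^sup>2 \<Delta>\<^sub>k + t\<^sub>k\<^sub>+\<^sub>1\<^sup>2 / (2\<beta>) \<parallel>v\<^sub>k - y\<^sup>*\<parallel>\<^sup>2 + 1 / (2\<gamma>) \<parallel>\<lambda>\<^sub>k - \<lambda>\<^sup>*\<parallel>\<^sup>2\<close> is nonincreasing: the optimality
  condition of the proximal step gives a descent inequality against any point, and one adds the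
  inequality against \<open>y\<^sub>k\<close> with weight \<open>t\<^sub>k\<^sub>+\<^sub>1 (t\<^sub>k\<^sub>+\<^sub>1 - 1)\<close> to the one against \<open>y\<^sup>*\<close> with weight \<open>t\<^sub>k\<^sub>+\<^sub>1\<close>;
  the bound on \<open>\<beta>\<close> absorbs the terms in \<open>\<parallel>v\<^sub>k\<^sub>+\<^sub>1 - v\<^sub>k\<parallel>\<^sup>2\<close>. This bounds \<open>t\<^sub>k\<^sup>2 \<Delta>\<^sub>k\<close> and
  \<open>\<parallel>\<lambda>\<^sub>k - \<lambda>\<^sup>*\<parallel>\<close>. The multiplier increments telescope to
  \<open>t\<^sub>k\<^sup>2 r\<^sub>k + \<Sum>\<^sub>i\<^sub><\<^sub>k d\<^sub>i t\<^sub>i\<^sup>2 r\<^sub>i\<close> with \<open>d\<^sub>i = (t\<^sub>i\<^sup>2 - t\<^sub>i\<^sub>+\<^sub>1\<^sup>2 + t\<^sub>i\<^sub>+\<^sub>1) / t\<^sub>i\<^sup>2 \<in> [0, 1]\<close>, so that these combinations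
  are bounded, and this forces the \<open>t\<^sub>k\<^sup>2 r\<^sub>k\<close> themselves to be bounded.
\<close>


lemma closed_fun_add_continuous:
  fixes h :: "'a::t2_space \<Rightarrow> ereal" and q :: "'a \<Rightarrow> real"
  assumes lsc: "closed_fun h" and no_minf: "\<And>x. h x \<noteq> -\<infinity>"
    and cont: "continuous_on UNIV q" and less: "c < h x + ereal (q x)"
  shows "\<forall>\<^sub>F u in nhds x. c < h u + ereal (q u)"
proof -
  have "c - ereal (q x) < h x"
    using less by (cases c; cases "h x") auto
  then obtain d where d: "c - ereal (q x) < ereal d" "ereal d < h x"
    using ereal_dense2 by blast
  have "ereal d < Liminf (at x) h"
    using lsc d(2) unfolding closed_fun_def by (meson less_le_trans)
  then have "\<forall>\<^sub>F u in at x. ereal d < h u"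
    by (rule less_LiminfD)
  then have ev1: "\<forall>\<^sub>F u in nhds x. ereal d < h u"
    using d(2) unfolding eventually_at_filter
    by (auto elim!: eventually_mono)
  have "isCont q x"
    using cont by (simp add: continuous_on_eq_continuous_at)
  then have "(q \<longlongrightarrow> q x) (nhds x)"
    by (simp add: isCont_def tendsto_at_iff_tendsto_nhds)
  then have "((\<lambda>u. ereal (d + q u)) \<longlongrightarrow> ereal (d + q x)) (nhds x)"
    by (intro tendsto_intros)
  moreover have "c < ereal (d + q x)"
    using d(1) by (cases c) auto
  ultimately have ev2: "\<forall>\<^sub>F u in nhds x. c < ereal (d + q u)"
    by (rule order_tendstoD(1))
  show ?thesis
    using ev1 ev2
  proof eventually_elim
    case (elim u)
    then show ?case using no_minf[of u] by (cases c; cases "h u") auto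
  qed
qed

lemma lsc_attains_min_on_compact:
  fixes F :: "'a::topological_space \<Rightarrow> 'b::linorder"
  assumes "compact K" "K \<noteq> {}"
    and lsc: "\<And>x c. c < F x \<Longrightarrow> \<forall>\<^sub>F u in nhds x. c < F u"
  obtains x where "x \<in> K" "\<And>u. u \<in> K \<Longrightarrow> F x \<le> F u"
proof (rule ccontr)
  assume "\<not> thesis"
  then have "\<forall>x\<in>K. \<exists>u\<in>K. F u < F x"
    using that by (meson not_le)
  then obtain p where p: "\<And>x. x \<in> K \<Longrightarrow> p x \<in> K \<and> F (p x) < F x"
    by metis
  have "\<forall>x\<in>K. \<exists>U. open U \<and> x \<in> U \<and> (\<forall>u\<in>U. F (p x) < F u)"
    using lsc p unfolding eventually_nhds by blast
  then obtain U where U: "\<And>x. x \<in> K \<Longrightarrow> open (U x) \<and> x \<in> U x \<and> (\<forall>u\<in>U x. F (p x) < F u)"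
    by metis
  obtain D where D: "D \<subseteq> K" "finite D" "K \<subseteq> (\<Union>x\<in>D. U x)"
    using \<open>compact K\<close> compactE_image[of K K U] U by blast
  have "D \<noteq> {}" using D \<open>K \<noteq> {}\<close> by auto
  define m where "m = Min ((\<lambda>x. F (p x)) ` D)"
  have "m \<in> (\<lambda>x. F (p x)) ` D"
    unfolding m_def using D \<open>D \<noteq> {}\<close> by (intro Min_in) auto
  then obtain x where x: "x \<in> D" "m = F (p x)" by auto
  then obtain x' where x': "x' \<in> D" "p x \<in> U x'" using D p by blast
  then have "F (p x') < m" using U D x by blast
  moreover have "m \<le> F (p x')" unfolding m_def using D x' by simp
  ultimately show False by simp
qed

lemma prox_minimizes:
  fixes h :: "'a::euclidean_space \<Rightarrow> ereal"
  assumes no_minf: "\<And>x. h x \<noteq> -\<infinity>" and "proper_fun h" and closed: "closed_fun h"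
    and convex: "ext_convex h" and "s > 0"
  shows "h (prox s h z) + ereal (1 / (2 * s) * (norm (prox s h z - z))\<^sup>2)
    \<le> h u + ereal (1 / (2 * s) * (norm (u - z))\<^sup>2)"
proof -
  define F where "F = (\<lambda>x. h x + ereal (1 / (2 * s) * (norm (x - z))\<^sup>2))"
  have lsc_F: "\<forall>\<^sub>F u in nhds x. c < F u" if "c < F x" for x c
    using that unfolding F_def
    by (intro closed_fun_add_continuous closed no_minf continuous_intros)
  have lsc_h: "\<forall>\<^sub>F u in nhds x. c < h u" if "c < h x" for x c
    using that closed_fun_add_continuous[OF closed no_minf, of "\<lambda>_. 0" c x]
    by (simp add: zero_ereal_def[symmetric])
  obtain x0 where x0: "h x0 < \<infinity>"
    using \<open>proper_fun h\<close> by (auto simp: proper_fun_def ext_dom_def)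
  then obtain a where a: "h x0 = ereal a" using no_minf[of x0] by (cases "h x0") auto
  obtain x1 where x1: "\<And>u. u \<in> cball x0 1 \<Longrightarrow> h x1 \<le> h u"
    using lsc_attains_min_on_compact[of "cball x0 1" h] lsc_h
    by (metis cball_eq_empty compact_cball not_one_less_zero)
  have "h x1 \<le> h x0" using x1 by simp
  then obtain m where m: "h x1 = ereal m" using no_minf[of x1] a by (cases "h x1") auto
  have "m \<le> a" using \<open>h x1 \<le> h x0\<close> a m by simp
  define D where "D = norm (x0 - z)"
  define R where "R = max 1 (2 * D + 2 * s * (a - m))"
  \<comment> \<open>By convexity along rays from \<open>x0\<close>, the lower bound \<open>m\<close> on the unit ball gives \<open>h\<close> an at most
    linear decrease, which the quadratic term outgrows.\<close>
  have far: "F x0 \<le> F x" if x: "norm (x - x0) > R" for x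
  proof (cases "h x")
    case (real c)
    define r where "r = norm (x - x0)"
    have r: "r > 1" "r > 2 * D + 2 * s * (a - m)" using x by (auto simp: r_def R_def)
    let ?p = "(1 - 1/r) *\<^sub>R x0 + (1/r) *\<^sub>R x"
    have "?p - x0 = (1/r) *\<^sub>R (x - x0)" by (simp add: algebra_simps)
    then have "norm (?p - x0) = 1" using r by (simp add: r_def[symmetric])
    then have "h x1 \<le> h ?p" by (intro x1) (simp add: dist_norm norm_minus_commute)
    also have "\<dots> \<le> ereal (1 - 1/r) * h x0 + ereal (1/r) * h x"
      using convex r unfolding ext_convex_def by simp
    finally have "m \<le> (1 - 1/r) * a + (1/r) * c" using a m real by simp
    then have "r * m \<le> r * ((1 - 1/r) * a + (1/r) * c)" using r by (intro mult_left_mono) auto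
    also have "\<dots> = r * a - a + c" using r by (simp add: field_simps)
    finally have c: "a - r * (a - m) \<le> c" by (simp add: algebra_simps)
    have "r - D \<le> norm (x - z)"
      using norm_triangle_ineq2[of "x - x0" "z - x0"] by (simp add: r_def D_def norm_minus_commute)
    moreover have "r \<ge> D"
    proof -
      have "0 \<le> 2 * s * (a - m)" using \<open>m \<le> a\<close> \<open>s > 0\<close> by simp
      then show ?thesis using r norm_ge_zero[of "x0 - z"] unfolding D_def[symmetric] by linarith
    qed
    ultimately have sq: "(r - D)\<^sup>2 \<le> (norm (x - z))\<^sup>2" by (intro power_mono) auto
    have "r * (2 * D + 2 * s * (a - m)) \<le> r * r" using r by (intro mult_left_mono) auto
    then have "D\<^sup>2 + 2 * s * (r * (a - m)) \<le> (r - D)\<^sup>2"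
      by (simp add: power2_eq_square algebra_simps)
    also note sq
    finally have "1 / (2 * s) * (D\<^sup>2 + 2 * s * (r * (a - m))) \<le> 1 / (2 * s) * (norm (x - z))\<^sup>2"
      using \<open>s > 0\<close> by (intro mult_left_mono) auto
    then have "1 / (2 * s) * D\<^sup>2 + r * (a - m) \<le> 1 / (2 * s) * (norm (x - z))\<^sup>2"
      using \<open>s > 0\<close> by (simp add: field_simps)
    then show ?thesis using c by (simp add: F_def real a D_def)
  qed (use no_minf[of x] in \<open>auto simp: F_def\<close>)
  have "R \<ge> 1" by (simp add: R_def)
  obtain xm where xm: "xm \<in> cball x0 R" "\<And>u. u \<in> cball x0 R \<Longrightarrow> F xm \<le> F u"
    using lsc_attains_min_on_compact[of "cball x0 R" F] lsc_F \<open>R \<ge> 1\<close> by auto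
  have min: "F xm \<le> F x" for x
  proof (cases "x \<in> cball x0 R")
    case False
    then have "F x0 \<le> F x" by (intro far) (simp add: dist_norm norm_minus_commute)
    moreover have "F xm \<le> F x0" using \<open>R \<ge> 1\<close> by (intro xm) auto
    ultimately show ?thesis by simp
  qed (rule xm)
  have "is_arg_min F (\<lambda>_. True) xm" using min by (simp add: is_arg_min_linorder)
  then have "is_arg_min F (\<lambda>_. True) (prox s h z)"
    unfolding prox_def arg_min_def F_def[symmetric] by (rule someI)
  then show ?thesis by (simp add: is_arg_min_linorder F_def)
qed

lemma prox_subgradient:
  fixes h :: "'a::euclidean_space \<Rightarrow> ereal"
  assumes no_minf: "\<And>x. h x \<noteq> -\<infinity>" and proper: "proper_fun h" and closed: "closed_fun h"
    and convex: "ext_convex h" and "s > 0"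
  shows "(1 / s) *\<^sub>R (z - prox s h z) \<in> subdifferential h (prox s h z)"
proof -
  define x where "x = prox s h z"
  have min: "h x + ereal (1 / (2 * s) * (norm (x - z))\<^sup>2) \<le> h u + ereal (1 / (2 * s) * (norm (u - z))\<^sup>2)" for u
    unfolding x_def by (rule prox_minimizes[OF assms])
  obtain x0 where x0: "h x0 < \<infinity>"
    using proper by (auto simp: proper_fun_def ext_dom_def)
  have dom: "h x < \<infinity>" using min[of x0] x0 by (cases "h x"; cases "h x0") auto
  then obtain a where a: "h x = ereal a" using no_minf[of x] by (cases "h x") auto
  have "h x + ereal (((1 / s) *\<^sub>R (z - x)) \<bullet> (u - x)) \<le> h u" for u
  proof (cases "h u")
    case (real c)
    have ineq: "a + (1 / s) * ((z - x) \<bullet> (u - x)) - l * (1 / (2 * s) * (norm (u - x))\<^sup>2) \<le> c"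
      if l: "0 < l" "l < 1" for l
    proof -
      let ?p = "(1 - l) *\<^sub>R x + l *\<^sub>R u"
      have "h ?p \<le> ereal (1 - l) * h x + ereal l * h u"
        using convex l unfolding ext_convex_def by simp
      then have "a + 1 / (2 * s) * (norm (x - z))\<^sup>2 \<le> (1 - l) * a + l * c + 1 / (2 * s) * (norm (?p - z))\<^sup>2"
        using min[of ?p] a real no_minf[of ?p] by (cases "h ?p") auto
      moreover have "(norm (?p - z))\<^sup>2 = (norm (x - z))\<^sup>2 - 2 * l * ((z - x) \<bullet> (u - x)) + l\<^sup>2 * (norm (u - x))\<^sup>2"
        unfolding power2_norm_eq_inner by (simp add: power2_eq_square inner_commute algebra_simps)
      moreover have "l * a + 1 / (2 * s) * (2 * l * i - l\<^sup>2 * d) \<le> l * c"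
        if "a + 1 / (2 * s) * n \<le> (1 - l) * a + l * c + 1 / (2 * s) * m" "m = n - 2 * l * i + l\<^sup>2 * d"
        for i d m n :: real
        using that(1) unfolding that(2) by (simp add: algebra_simps)
      ultimately have "l * a + 1 / (2 * s) * (2 * l * ((z - x) \<bullet> (u - x)) - l\<^sup>2 * (norm (u - x))\<^sup>2) \<le> l * c"
        by blast
      moreover have "1 / (2 * s) * (2 * l * ((z - x) \<bullet> (u - x)) - l\<^sup>2 * (norm (u - x))\<^sup>2)
         = l * ((1 / s) * ((z - x) \<bullet> (u - x)) - l * (1 / (2 * s) * (norm (u - x))\<^sup>2))"
        using \<open>s > 0\<close> by (simp add: field_simps power2_eq_square)
      ultimately have "l * (a + (1 / s) * ((z - x) \<bullet> (u - x)) - l * (1 / (2 * s) * (norm (u - x))\<^sup>2)) \<le> l * c"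
        by (metis add_diff_eq distrib_left)
      then show ?thesis using l by simp
    qed
    have "((\<lambda>l. a + (1 / s) * ((z - x) \<bullet> (u - x)) - l * (1 / (2 * s) * (norm (u - x))\<^sup>2)) \<longlongrightarrow>
      a + (1 / s) * ((z - x) \<bullet> (u - x)) - 0 * (1 / (2 * s) * (norm (u - x))\<^sup>2)) (at_right 0)"
      by (intro tendsto_intros)
    moreover have "\<forall>\<^sub>F l in at_right (0::real). a + (1 / s) * ((z - x) \<bullet> (u - x)) - l * (1 / (2 * s) * (norm (u - x))\<^sup>2) \<le> c"
      using eventually_at_right_real[OF zero_less_one] by eventually_elim (use ineq in auto)
    ultimately have "a + (1 / s) * ((z - x) \<bullet> (u - x)) - 0 * (1 / (2 * s) * (norm (u - x))\<^sup>2) \<le> c"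
      by (intro tendsto_upperbound) auto
    then show ?thesis using a real by simp
  qed (use no_minf[of u] in auto)
  then show ?thesis using dom by (simp add: subdifferential_def ext_dom_def x_def)
qed

lemma GDERIV_along_line:
  assumes "\<And>x. GDERIV f x :> f' x"
  shows "((\<lambda>s. f (x + s *\<^sub>R d)) has_real_derivative f' (x + s *\<^sub>R d) \<bullet> d) (at s)"
proof -
  have "((\<lambda>s. x + s *\<^sub>R d) has_derivative (\<lambda>r. r *\<^sub>R d)) (at s)"
    by (auto intro!: derivative_eq_intros)
  moreover have "(f has_derivative (\<lambda>h. h \<bullet> f' (x + s *\<^sub>R d))) (at (x + s *\<^sub>R d))"
    using assms unfolding gderiv_def by simp
  ultimately have "((\<lambda>s. f (x + s *\<^sub>R d)) has_derivative (\<lambda>r. (r *\<^sub>R d) \<bullet> f' (x + s *\<^sub>R d))) (at s)"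
    by (rule has_derivative_compose)
  then show ?thesis
    unfolding has_field_derivative_def by (simp add: inner_commute mult_commute_abs)
qed

lemma descent_lemma:
  assumes deriv: "\<And>x. GDERIV f x :> f' x" and lip: "L-lipschitz_on UNIV f'"
  shows "f y \<le> f x + f' x \<bullet> (y - x) + L / 2 * (norm (y - x))\<^sup>2"
proof -
  define d where "d = y - x"
  define \<phi> where "\<phi> s = f (x + s *\<^sub>R d) - s * (f' x \<bullet> d) - L / 2 * s\<^sup>2 * (norm d)\<^sup>2" for s
  have \<phi>': "(\<phi> has_real_derivative f' (x + s *\<^sub>R d) \<bullet> d - f' x \<bullet> d - L * s * (norm d)\<^sup>2) (at s)" for s
    unfolding \<phi>_def
    by (auto intro!: derivative_eq_intros GDERIV_along_line[OF deriv])
  have nonpos: "f' (x + s *\<^sub>R d) \<bullet> d - f' x \<bullet> d - L * s * (norm d)\<^sup>2 \<le> 0" if "0 \<le> s" for s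
  proof -
    have "f' (x + s *\<^sub>R d) \<bullet> d - f' x \<bullet> d \<le> norm (f' (x + s *\<^sub>R d) - f' x) * norm d"
      unfolding inner_diff_left[symmetric] by (rule norm_cauchy_schwarz)
    also have "\<dots> \<le> (L * norm (s *\<^sub>R d)) * norm d"
      using lipschitz_onD[OF lip, of "x + s *\<^sub>R d" x] by (intro mult_right_mono) (auto simp: dist_norm)
    also have "\<dots> = L * s * (norm d)\<^sup>2" using that by (simp add: power2_eq_square)
    finally show ?thesis by simp
  qed
  have "\<phi> 1 \<le> \<phi> 0"
    by (rule DERIV_nonpos_imp_nonincreasing) (use \<phi>' nonpos in force)+
  then show ?thesis by (simp add: \<phi>_def d_def)
qed

lemma convex_on_above_gradient:
  assumes conv: "convex_on UNIV f" and deriv: "\<And>x. GDERIV f x :> f' x"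
  shows "f x + f' x \<bullet> (y - x) \<le> f y"
proof -
  define \<phi> where "\<phi> s = f (x + s *\<^sub>R (y - x))" for s
  have "convex_on UNIV \<phi>"
  proof (rule convex_onI)
    fix l a b :: real assume l: "0 < l" "l < 1"
    have "x + ((1 - l) *\<^sub>R a + l *\<^sub>R b) *\<^sub>R (y - x)
       = (1 - l) *\<^sub>R (x + a *\<^sub>R (y - x)) + l *\<^sub>R (x + b *\<^sub>R (y - x))"
      by (simp add: algebra_simps)
    then show "\<phi> ((1 - l) *\<^sub>R a + l *\<^sub>R b) \<le> (1 - l) * \<phi> a + l * \<phi> b"
      unfolding \<phi>_def using convex_onD[OF conv, of l] l by simp
  qed auto
  moreover have "(\<phi> has_real_derivative f' x \<bullet> (y - x)) (at 0)"
    using GDERIV_along_line[OF deriv, where x = x and d = "y - x" and s = 0]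
    unfolding \<phi>_def by simp
  ultimately have "\<phi> 1 - \<phi> 0 \<ge> (f' x \<bullet> (y - x)) * (1 - 0)"
    by (intro convex_on_imp_above_tangent[where A = UNIV]) auto
  then show ?thesis by (simp add: \<phi>_def)
qed

lemma prox_gradient_inequality:
  fixes h :: "'a::euclidean_space \<Rightarrow> ereal" and z :: 'a
  assumes no_minf: "\<And>x. h x \<noteq> -\<infinity>" and "proper_fun h" "closed_fun h"
    and h: "strongly_convex_fun \<mu> h" and "s > 0"
    and f: "convex_on UNIV f" "\<And>x. GDERIV f x :> f' x" "L-lipschitz_on UNIV f'"
    and u: "h u < \<infinity>"
  defines "x \<equiv> prox s h z"
  shows "(real_of_ereal (h x) + f x) - (real_of_ereal (h u) + f u)
    \<le> ((1 / s) *\<^sub>R (z - x) + f' w) \<bullet> (x - u) + L / 2 * (norm (x - w))\<^sup>2 - \<mu> / 2 * (norm (u - x))\<^sup>2"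
    and "h x < \<infinity>"
proof -
  have \<xi>: "(1 / s) *\<^sub>R (z - x) \<in> subdifferential h x"
    using h assms unfolding x_def strongly_convex_fun_def by (intro prox_subgradient) auto
  then show "h x < \<infinity>" by (simp add: subdifferential_def ext_dom_def)
  have "h u - h x - ereal (((1 / s) *\<^sub>R (z - x)) \<bullet> (u - x)) \<ge> ereal (\<mu> / 2 * (norm (u - x))\<^sup>2)"
    using h \<xi> unfolding strongly_convex_fun_def by blast
  then have "real_of_ereal (h u) - real_of_ereal (h x) - ((1 / s) *\<^sub>R (z - x)) \<bullet> (u - x)
      \<ge> \<mu> / 2 * (norm (u - x))\<^sup>2"
    using \<open>h x < \<infinity>\<close> u no_minf[of x] no_minf[of u] by (cases "h x"; cases "h u") auto
  moreover have "f x \<le> f w + f' w \<bullet> (x - w) + L / 2 * (norm (x - w))\<^sup>2"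
    using f by (intro descent_lemma) auto
  moreover have "f w + f' w \<bullet> (u - w) \<le> f u"
    using f by (intro convex_on_above_gradient) auto
  ultimately show "(real_of_ereal (h x) + f x) - (real_of_ereal (h u) + f u)
    \<le> ((1 / s) *\<^sub>R (z - x) + f' w) \<bullet> (x - u) + L / 2 * (norm (x - w))\<^sup>2 - \<mu> / 2 * (norm (u - x))\<^sup>2"
    by (simp add: algebra_simps)
qed

lemma norm_le_if_weighted_sums_bounded:
  fixes a :: "nat \<Rightarrow> 'a::real_normed_vector"
  assumes d: "\<And>i. 0 \<le> d i" "\<And>i. d i \<le> 1"
    and bound: "\<And>k. norm (a k + (\<Sum>i<k. d i *\<^sub>R a i)) \<le> C"
  shows "norm (a k) \<le> 2 * C"
proof -
  define S where "S k = (\<Sum>i<k. d i *\<^sub>R a i)" for k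
  have "C \<ge> 0" using bound[of 0] norm_ge_zero order_trans by blast
  have S: "norm (S k) \<le> C" for k
  proof (induction k)
    case (Suc k)
    have "S (Suc k) = (1 - d k) *\<^sub>R S k + d k *\<^sub>R (a k + S k)"
      by (simp add: S_def algebra_simps)
    also have "norm \<dots> \<le> (1 - d k) * norm (S k) + d k * norm (a k + S k)"
      using d[of k] by (intro order_trans[OF norm_triangle_ineq]) simp
    also have "\<dots> \<le> (1 - d k) * C + d k * C"
      using d[of k] Suc bound[of k] by (intro add_mono mult_left_mono) (auto simp: S_def)
    finally show ?case by (simp add: algebra_simps)
  qed (use \<open>C \<ge> 0\<close> in \<open>simp add: S_def\<close>)
  have "norm (a k) \<le> norm (a k + S k) + norm (S k)"
    using norm_triangle_ineq4[of "a k + S k" "S k"] by simp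
  then show ?thesis using S[of k] bound[of k] by (simp add: S_def)
qed

lemma inner_diff_polarization:
  fixes x y z :: "'a::real_inner"
  shows "(x - y) \<bullet> (x - z) = ((norm (x - z))\<^sup>2 + (norm (x - y))\<^sup>2 - (norm (y - z))\<^sup>2) / 2"
  unfolding power2_norm_eq_inner by (simp add: inner_commute algebra_simps)

lemma primal_energy_step:
  fixes y y' v v' yb ys p :: "'a::real_inner" and t \<beta> \<mu> L :: real
  assumes t: "t \<ge> 1" and \<beta>: "\<beta> > 0" and \<mu>: "\<mu> \<ge> 0"
    and v': "v' = y' + (t - 1) *\<^sub>R (y' - y)" and yb: "v' - v = t *\<^sub>R (y' - yb)"
    and w: "w = - (t / \<beta>) *\<^sub>R (v' - v) - \<mu> *\<^sub>R (v' - y') - p"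
    and I1: "G' - G \<le> w \<bullet> (y' - y) + L / 2 * (norm (y' - yb))\<^sup>2 - \<mu> / 2 * (norm (y - y'))\<^sup>2"
    and I2: "G' - Gs \<le> w \<bullet> (y' - ys) + L / 2 * (norm (y' - yb))\<^sup>2 - \<mu> / 2 * (norm (ys - y'))\<^sup>2"
  shows "t\<^sup>2 * (G' - Gs) - (t\<^sup>2 - t) * (G - Gs) + t * (p \<bullet> (v' - ys))
    \<le> t\<^sup>2 / (2 * \<beta>) * (norm (v - ys))\<^sup>2 - (t\<^sup>2 + \<beta> * \<mu> * t) / (2 * \<beta>) * (norm (v' - ys))\<^sup>2
      - (t\<^sup>2 / \<beta> - L) / 2 * (norm (v' - v))\<^sup>2"
proof -
  have tt: "t\<^sup>2 - t = t * (t - 1)" by (simp add: power2_eq_square algebra_simps)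
  define q where "q = t\<^sup>2 * (norm (y' - yb))\<^sup>2"
  have q: "q = (norm (v' - v))\<^sup>2" unfolding q_def yb by (simp add: power_mult_distrib)
  have vy: "(norm (v' - y'))\<^sup>2 = (t - 1)\<^sup>2 * (norm (y - y'))\<^sup>2"
    unfolding v' by (simp add: power_mult_distrib norm_minus_commute)
  have "(t - 1) *\<^sub>R (y' - y) + (y' - ys) = v' - ys" unfolding v' by simp
  then have ww: "(t - 1) * (w \<bullet> (y' - y)) + w \<bullet> (y' - ys) = w \<bullet> (v' - ys)"
    by (metis inner_add_right inner_scaleR_right)
  have "t\<^sup>2 * (G' - Gs) - (t\<^sup>2 - t) * (G - Gs) = (t * (t - 1)) * (G' - G) + t * (G' - Gs)"
    unfolding tt by (simp add: power2_eq_square algebra_simps)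
  also have "\<dots> \<le> (t * (t - 1)) * (w \<bullet> (y' - y) + L / 2 * (norm (y' - yb))\<^sup>2 - \<mu> / 2 * (norm (y - y'))\<^sup>2)
      + t * (w \<bullet> (y' - ys) + L / 2 * (norm (y' - yb))\<^sup>2 - \<mu> / 2 * (norm (ys - y'))\<^sup>2)"
    using t I1 I2 by (intro add_mono mult_left_mono) auto
  also have "\<dots> = t * ((t - 1) * (w \<bullet> (y' - y)) + w \<bullet> (y' - ys)) + L / 2 * q
      - \<mu> * t / 2 * ((t - 1) * (norm (y - y'))\<^sup>2 + (norm (ys - y'))\<^sup>2)"
    unfolding q_def by (simp add: power2_eq_square algebra_simps diff_divide_distrib)
  also have "\<dots> \<le> t * (w \<bullet> (v' - ys)) + L / 2 * q - \<mu> * t / 2 * (norm (ys - y'))\<^sup>2"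
  proof -
    have "0 \<le> \<mu> * t / 2 * ((t - 1) * (norm (y - y'))\<^sup>2)" using t \<mu> by simp
    then show ?thesis unfolding ww distrib_left[of "\<mu> * t / 2"] by linarith
  qed
  also have "w \<bullet> (v' - ys) = - (t / \<beta>) * ((v' - v) \<bullet> (v' - ys)) - \<mu> * ((v' - y') \<bullet> (v' - ys)) - p \<bullet> (v' - ys)"
    unfolding w by (simp only: inner_diff_left inner_scaleR_left)
  also have "t * \<dots> + L / 2 * q - \<mu> * t / 2 * (norm (ys - y'))\<^sup>2
    = t\<^sup>2 / (2 * \<beta>) * (norm (v - ys))\<^sup>2 - (t\<^sup>2 / (2 * \<beta>) + \<mu> * t / 2) * (norm (v' - ys))\<^sup>2
      - (t\<^sup>2 / \<beta> - L) / 2 * (norm (v' - v))\<^sup>2 - t * (p \<bullet> (v' - ys)) - \<mu> * t / 2 * (norm (v' - y'))\<^sup>2"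
    unfolding inner_diff_polarization q norm_minus_commute[of ys y'] using \<beta>
    by (simp add: field_simps power2_eq_square)
  also have "t\<^sup>2 / (2 * \<beta>) + \<mu> * t / 2 = (t\<^sup>2 + \<beta> * \<mu> * t) / (2 * \<beta>)"
    using \<beta> by (simp add: field_simps)
  finally have "t\<^sup>2 * (G' - Gs) - (t\<^sup>2 - t) * (G - Gs) + t * (p \<bullet> (v' - ys)) + \<mu> * t / 2 * (norm (v' - y'))\<^sup>2
    \<le> t\<^sup>2 / (2 * \<beta>) * (norm (v - ys))\<^sup>2 - (t\<^sup>2 + \<beta> * \<mu> * t) / (2 * \<beta>) * (norm (v' - ys))\<^sup>2
      - (t\<^sup>2 / \<beta> - L) / 2 * (norm (v' - v))\<^sup>2" by simp
  moreover have "\<mu> * t / 2 * (norm (v' - y'))\<^sup>2 \<ge> 0" using t \<mu> by simp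
  ultimately show ?thesis by linarith
qed

lemma dual_energy_step:
  fixes l l' lb ls s s' :: "'a::real_inner"
  assumes \<gamma>: "\<gamma> > 0" and l': "l' = l + (\<gamma> * t) *\<^sub>R s'" and lb: "lb = l + (\<gamma> * t) *\<^sub>R s"
  shows "t * ((ls - lb) \<bullet> s')
    \<le> 1 / (2 * \<gamma>) * (norm (l - ls))\<^sup>2 - 1 / (2 * \<gamma>) * (norm (l' - ls))\<^sup>2 + \<gamma> * t\<^sup>2 / 2 * (norm (s' - s))\<^sup>2"
proof -
  have "norm (l' - lb) = norm ((\<gamma> * t) *\<^sub>R (s' - s))"
    unfolding l' lb by (simp add: algebra_simps)
  then have q: "(norm (l' - lb))\<^sup>2 = \<gamma>\<^sup>2 * t\<^sup>2 * (norm (s' - s))\<^sup>2"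
    by (simp add: power_mult_distrib)
  have "2 * \<gamma> * (t * ((ls - lb) \<bullet> s')) = 2 * ((ls - lb) \<bullet> (l' - l))"
    unfolding l' by simp
  also have "\<dots> = (norm (l - ls))\<^sup>2 - (norm (l' - ls))\<^sup>2 + (norm (l' - lb))\<^sup>2 - (norm (l - lb))\<^sup>2"
    unfolding power2_norm_eq_inner by (simp add: inner_commute algebra_simps)
  also have "\<dots> \<le> (norm (l - ls))\<^sup>2 - (norm (l' - ls))\<^sup>2 + \<gamma>\<^sup>2 * t\<^sup>2 * (norm (s' - s))\<^sup>2"
    unfolding q by simp
  finally have "t * ((ls - lb) \<bullet> s') \<le> ((norm (l - ls))\<^sup>2 - (norm (l' - ls))\<^sup>2 + \<gamma>\<^sup>2 * t\<^sup>2 * (norm (s' - s))\<^sup>2) / (2 * \<gamma>)"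
    using \<gamma> by (simp add: field_simps)
  also have "\<dots> = 1 / (2 * \<gamma>) * (norm (l - ls))\<^sup>2 - 1 / (2 * \<gamma>) * (norm (l' - ls))\<^sup>2 + \<gamma> * t\<^sup>2 / 2 * (norm (s' - s))\<^sup>2"
    using \<gamma> by (simp add: field_simps power2_eq_square)
  finally show ?thesis .
qed

lemma saddle_points_finite_feasible:
  assumes no_minf: "\<And>x. g x \<noteq> -\<infinity>" and "g x0 < \<infinity>" and "(ys, ls) \<in> saddle_points g B b"
  shows "g ys < \<infinity>" and "B *v ys = b"
    and "\<And>x. g ys \<le> g x + ereal (ls \<bullet> (B *v x - b))"
proof -
  have 1: "lagrangian g B b ys l \<le> lagrangian g B b ys ls"
    and 2: "lagrangian g B b ys ls \<le> lagrangian g B b x ls" for x l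
    using assms(3) unfolding saddle_points_def by auto
  show fin: "g ys < \<infinity>"
    using 2[of x0] \<open>g x0 < \<infinity>\<close> unfolding lagrangian_def by (cases "g ys"; cases "g x0") auto
  then obtain c where c: "g ys = ereal c" using no_minf[of ys] by (cases "g ys") auto
  have "(ls + (B *v ys - b)) \<bullet> (B *v ys - b) \<le> ls \<bullet> (B *v ys - b)"
    using 1[of "ls + (B *v ys - b)"] unfolding lagrangian_def c by simp
  then have "(B *v ys - b) \<bullet> (B *v ys - b) \<le> 0" by (simp add: inner_add_left)
  then show feas: "B *v ys = b" by (metis eq_iff_diff_eq_0 inner_eq_zero_iff inner_ge_zero order_antisym)
  show "g ys \<le> g x + ereal (ls \<bullet> (B *v x - b))" for x
    using 2[of x] unfolding lagrangian_def feas by simp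
qed

theorem theorem4:
  fixes g1 g :: "real^'n \<Rightarrow> ereal"
    and g2 :: "real^'n \<Rightarrow> real"
    and grad_g2 :: "real^'n \<Rightarrow> real^'n"
    and B :: "real^'n^'p" and b :: "real^'p"
    and \<mu>g Lg2 \<beta> \<gamma> :: real
    and t :: "nat \<Rightarrow> real"
    and y v :: "nat \<Rightarrow> real^'n" and lam :: "nat \<Rightarrow> real^'p"
    and ystar :: "real^'n" and lamstar :: "real^'p"
  assumes g1_no_minf: "\<And>x. g1 x \<noteq> -\<infinity>"
    and g1_proper: "proper_fun g1"
    and g1_closed: "closed_fun g1"
    and mu_pos: "\<mu>g > 0"
    and g1_strongly_convex: "strongly_convex_fun \<mu>g g1"
    and g2_convex: "convex_on UNIV g2"
    and g2_gradient: "\<And>x. GDERIV g2 x :> grad_g2 x"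
    and g2_gradient_Lipschitz: "Lg2-lipschitz_on UNIV grad_g2"
    and g_def: "g = (\<lambda>x. g1 x + ereal (g2 x))"
    and saddle: "(ystar, lamstar) \<in> saddle_points g B b"
    and beta_pos: "\<beta> > 0" and gamma_pos: "\<gamma> > 0"
    and algorithm: "generated_by_algorithm g1 grad_g2 B b \<mu>g \<beta> \<gamma> t y v lam"
    and beta_bound:
      "ereal \<beta> \<le> ereal ((t 1)\<^sup>2) / ereal (Lg2 + (t 1)\<^sup>2 * \<gamma> * (onorm ((*v) B))\<^sup>2)"
    and t_ge_1: "\<And>k. k \<ge> 1 \<Longrightarrow> t k \<ge> 1"
    and t_mono: "\<And>k. k \<ge> 1 \<Longrightarrow> t k \<le> t (k + 1)"
    and t_growth1: "\<And>k. k \<ge> 1 \<Longrightarrow> (t (k + 1))\<^sup>2 \<le> (t k)\<^sup>2 + t (k + 1)"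
    and t_growth2: "\<And>k. k \<ge> 1 \<Longrightarrow> (t (k + 1))\<^sup>2 \<le> (t k)\<^sup>2 + \<beta> * \<mu>g * t k"
  shows "let E1 = (t 1)\<^sup>2 * (real_of_ereal (g (y 1)) - real_of_ereal (g ystar)
                              + lamstar \<bullet> (B *v y 1 - b))
                  + (t 2)\<^sup>2 / (2 * \<beta>) * (norm (y 1 - ystar))\<^sup>2
                  + 1 / (2 * \<gamma>) * (norm (lam 1 - lamstar))\<^sup>2;
             C4 = 3 * (t 1)\<^sup>2 * norm (B *v y 1 - b)
                  + (2 * norm (lam 1 - lamstar) + 2 * sqrt (2 * \<gamma> * E1)) / \<gamma>
         in \<forall>k\<ge>1. norm (B *v y k - b) \<le> C4 / (t k)\<^sup>2 \<and>
                  \<bar>g (y k) - g ystar\<bar> \<le> ereal ((E1 + C4 * norm lamstar) / (t k)\<^sup>2)"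
proof -
  define K where "K = onorm ((*v) B)"
  have K: "norm (B *v x) \<le> K * norm x" for x
    unfolding K_def by (rule onorm) (rule matrix_vector_mul_bounded_linear)
  have "Lg2 \<ge> 0" using g2_gradient_Lipschitz by (rule lipschitz_on_nonneg)
  have t_pos: "t k > 0" if "k \<ge> 1" for k using t_ge_1[OF that] by simp
  have t1_le: "t 1 \<le> t k" if "k \<ge> 1" for k
    using that by (induction k rule: dec_induct) (use t_mono in force)+
  have step_size: "Lg2 + \<gamma> * (t k)\<^sup>2 * K\<^sup>2 \<le> (t k)\<^sup>2 / \<beta>" if "k \<ge> 1" for k
  proof -
    define D where "D = Lg2 + (t 1)\<^sup>2 * \<gamma> * K\<^sup>2"
    have "D \<ge> 0" using \<open>Lg2 \<ge> 0\<close> gamma_pos by (simp add: D_def)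
    have "\<beta> * D \<le> (t 1)\<^sup>2"
    proof (cases "D = 0")
      case False
      then have "\<beta> \<le> (t 1)\<^sup>2 / D" using beta_bound by (simp add: D_def K_def)
      then show ?thesis using False \<open>D \<ge> 0\<close> by (simp add: field_simps)
    qed simp
    then have *: "\<beta> * Lg2 \<le> (t 1)\<^sup>2 * (1 - \<beta> * \<gamma> * K\<^sup>2)" by (simp add: D_def algebra_simps)
    moreover have "0 \<le> \<beta> * Lg2" using beta_pos \<open>Lg2 \<ge> 0\<close> by simp
    ultimately have "0 \<le> (t 1)\<^sup>2 * (1 - \<beta> * \<gamma> * K\<^sup>2)" by linarith
    then have "0 \<le> 1 - \<beta> * \<gamma> * K\<^sup>2" using t_pos[of 1] by (simp add: zero_le_mult_iff)
    moreover have "(t 1)\<^sup>2 \<le> (t k)\<^sup>2" using t1_le[OF that] t_pos[of 1] by (intro power_mono) auto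
    ultimately have "\<beta> * Lg2 \<le> (t k)\<^sup>2 * (1 - \<beta> * \<gamma> * K\<^sup>2)"
      using * by (meson mult_right_mono order_trans)
    then show ?thesis using beta_pos by (simp add: field_simps)
  qed

  have y0: "y 1 = y 0" "v 1 = y 0" "g1 (y 0) < \<infinity>"
    using algorithm unfolding generated_by_algorithm_def ext_dom_def by auto
  have no_minf: "g x \<noteq> -\<infinity>" for x using g1_no_minf[of x] by (simp add: g_def)
  have finite_iff: "g x < \<infinity> \<longleftrightarrow> g1 x < \<infinity>" for x by (simp add: g_def less_top[symmetric])
  note sp = saddle_points_finite_feasible[OF no_minf _ saddle, of "y 0", unfolded finite_iff, OF y0(3)]
  define G where "G x = real_of_ereal (g x)" for x
  have g_eq: "g x = ereal (G x)" if "g1 x < \<infinity>" for x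
    using that g1_no_minf[of x] by (cases "g1 x") (auto simp: G_def g_def)
  have G_eq: "G x = real_of_ereal (g1 x) + g2 x" if "g1 x < \<infinity>" for x
    using that g1_no_minf[of x] by (cases "g1 x") (auto simp: G_def g_def)
  define r where "r k = B *v y k - b" for k
  define \<Delta> where "\<Delta> k = G (y k) - G ystar + lamstar \<bullet> r k" for k
  define E where "E k = (t k)\<^sup>2 * \<Delta> k + (t (k + 1))\<^sup>2 / (2 * \<beta>) * (norm (v k - ystar))\<^sup>2
    + 1 / (2 * \<gamma>) * (norm (lam k - lamstar))\<^sup>2" for k

  define ybar where "ybar k = y k + ((t k - 1) / t (k + 1)) *\<^sub>R (y k - y (k - 1))" for k
  define lambar where "lambar k = lam k + (\<gamma> * t (k + 1)) *\<^sub>R (B *v v k - b)" for k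
  define \<eta> where "\<eta> k = \<beta> / ((t (k + 1))\<^sup>2 + \<beta> * \<mu>g * (t (k + 1) - 1))" for k
  define p where "p k = transpose B *v lambar k" for k
  define z where "z k = ybar k - \<eta> k *\<^sub>R ((\<mu>g * (t (k + 1) - 1)) *\<^sub>R (ybar k - y k) + p k + grad_g2 (ybar k))" for k
  have y_next: "y (k + 1) = prox (\<eta> k) g1 (z k)"
    and v_next: "v (k + 1) = y (k + 1) + (t (k + 1) - 1) *\<^sub>R (y (k + 1) - y k)"
    and lam_next: "lam (k + 1) = lam k + (\<gamma> * t (k + 1)) *\<^sub>R (B *v v (k + 1) - b)" if "k \<ge> 1" for k
    using algorithm that unfolding generated_by_algorithm_def Let_def
      z_def p_def \<eta>_def lambar_def ybar_def by blast+
  have \<eta>_den: "(t (k + 1))\<^sup>2 + \<beta> * \<mu>g * (t (k + 1) - 1) > 0" for k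
    using t_ge_1[of "k + 1"] beta_pos mu_pos by (intro add_pos_nonneg) auto
  have \<eta>_pos: "\<eta> k > 0" for k
    using \<eta>_den[of k] beta_pos unfolding \<eta>_def by simp
  note prox_ineq = prox_gradient_inequality[OF g1_no_minf g1_proper g1_closed g1_strongly_convex
      _ g2_convex g2_gradient g2_gradient_Lipschitz]
  have fin: "g1 (y k) < \<infinity>" if "k \<ge> 1" for k
    using that
  proof (induction k rule: dec_induct)
    case (step k)
    then show ?case using prox_ineq(2)[OF \<eta>_pos[of k] step.IH, where z = "z k"] y_next[of k] by simp
  qed (use y0 in simp)
  have \<Delta>_nonneg: "\<Delta> k \<ge> 0" if "k \<ge> 1" for k
    using sp(3)[of "y k"] unfolding g_eq[OF fin[OF that]] g_eq[OF sp(1)]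
    by (simp add: \<Delta>_def r_def)

  have v_eq: "v k = y k + (t k - 1) *\<^sub>R (y k - y (k - 1))" if "k \<ge> 1" for k
  proof (cases "k = 1")
    case False
    then show ?thesis using v_next[of "k - 1"] that by simp
  qed (use y0 in simp)
  have constraint_v: "t (k + 1) *\<^sub>R (B *v v (k + 1) - b)
      = (t (k + 1))\<^sup>2 *\<^sub>R r (k + 1) - ((t (k + 1))\<^sup>2 - t (k + 1)) *\<^sub>R r k" if "k \<ge> 1" for k
    unfolding v_next[OF that] r_def
    by (simp add: algebra_simps power2_eq_square)
  have E_step: "E (k + 1) \<le> E k" if k: "k \<ge> 1" for k
  proof -
    let ?t = "t (k + 1)"
    let ?dv = "v (k + 1) - v k"
    define w where "w = (1 / \<eta> k) *\<^sub>R (z k - y (k + 1)) + grad_g2 (ybar k)"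
    have t: "?t \<ge> 1" using t_ge_1 by simp
    have yb: "?t *\<^sub>R (ybar k - y k) = v k - y k"
      unfolding ybar_def v_eq[OF k] using t by simp
    have dv: "?dv = ?t *\<^sub>R (y (k + 1) - ybar k)"
    proof -
      have "?t *\<^sub>R (y (k + 1) - ybar k) = ?t *\<^sub>R (y (k + 1) - y k) - ?t *\<^sub>R (ybar k - y k)"
        by (simp add: algebra_simps)
      then show ?thesis unfolding yb v_next[OF k] by (simp add: algebra_simps)
    qed
    have "1 / \<eta> k = ?t\<^sup>2 / \<beta> + \<mu>g * (?t - 1)"
      unfolding \<eta>_def using beta_pos by (simp add: field_simps)
    moreover have "w = (1 / \<eta> k) *\<^sub>R (ybar k - y (k + 1))
        - (\<mu>g * (?t - 1)) *\<^sub>R (ybar k - y k) - p k"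
      unfolding w_def z_def using \<eta>_pos[of k] by (simp add: algebra_simps)
    ultimately have "w = (?t\<^sup>2 / \<beta> + \<mu>g * (?t - 1)) *\<^sub>R (ybar k - y (k + 1))
        - (\<mu>g * (?t - 1)) *\<^sub>R (ybar k - y k) - p k"
      by simp
    then have "w = - (?t\<^sup>2 / \<beta>) *\<^sub>R (y (k + 1) - ybar k) - (\<mu>g * (?t - 1)) *\<^sub>R (y (k + 1) - y k) - p k"
      by (simp add: algebra_simps)
    then have w: "w = - (?t / \<beta>) *\<^sub>R ?dv - \<mu>g *\<^sub>R (v (k + 1) - y (k + 1)) - p k"
      unfolding dv unfolding v_next[OF k] by (simp add: power2_eq_square)
    have p: "p k \<bullet> (v (k + 1) - ystar) = lambar k \<bullet> (B *v v (k + 1) - b)"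
      unfolding p_def using sp(2)
      by (metis dot_lmul_matrix matrix_vector_mult_diff_distrib transpose_matrix_vector)
    have primal: "?t\<^sup>2 * (G (y (k + 1)) - G ystar) - (?t\<^sup>2 - ?t) * (G (y k) - G ystar)
        + ?t * (lambar k \<bullet> (B *v v (k + 1) - b))
      \<le> ?t\<^sup>2 / (2 * \<beta>) * (norm (v k - ystar))\<^sup>2
        - (?t\<^sup>2 + \<beta> * \<mu>g * ?t) / (2 * \<beta>) * (norm (v (k + 1) - ystar))\<^sup>2
        - (?t\<^sup>2 / \<beta> - Lg2) / 2 * (norm ?dv)\<^sup>2"
    proof (rule primal_energy_step[where ys = ystar, OF t beta_pos _ v_next[OF k] dv w, unfolded p])
      show "G (y (k + 1)) - G (y k) \<le> w \<bullet> (y (k + 1) - y k)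
          + Lg2 / 2 * (norm (y (k + 1) - ybar k))\<^sup>2 - \<mu>g / 2 * (norm (y k - y (k + 1)))\<^sup>2"
        using prox_ineq(1)[OF \<eta>_pos[of k] fin[OF k], where z = "z k" and w = "ybar k"] fin[of "k + 1"] fin[OF k]
        unfolding y_next[OF k, symmetric] w_def by (simp add: G_eq)
      show "G (y (k + 1)) - G ystar \<le> w \<bullet> (y (k + 1) - ystar)
          + Lg2 / 2 * (norm (y (k + 1) - ybar k))\<^sup>2 - \<mu>g / 2 * (norm (ystar - y (k + 1)))\<^sup>2"
        using prox_ineq(1)[OF \<eta>_pos[of k] sp(1), where z = "z k" and w = "ybar k"] fin[of "k + 1"] sp(1)
        unfolding y_next[OF k, symmetric] w_def by (simp add: G_eq)
    qed (use mu_pos in simp)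
    have dual: "?t * ((lamstar - lambar k) \<bullet> (B *v v (k + 1) - b))
      \<le> 1 / (2 * \<gamma>) * (norm (lam k - lamstar))\<^sup>2 - 1 / (2 * \<gamma>) * (norm (lam (k + 1) - lamstar))\<^sup>2
        + \<gamma> * ?t\<^sup>2 / 2 * (norm (B *v ?dv))\<^sup>2"
      using dual_energy_step[OF gamma_pos lam_next[OF k] lambar_def, of lamstar]
      by (simp add: matrix_vector_mult_diff_distrib)
    have "(norm (B *v ?dv))\<^sup>2 \<le> K\<^sup>2 * (norm ?dv)\<^sup>2"
      using power_mono[OF K, of ?dv 2] by (simp add: power_mult_distrib)
    then have "\<gamma> * ?t\<^sup>2 / 2 * (norm (B *v ?dv))\<^sup>2 \<le> \<gamma> * ?t\<^sup>2 / 2 * (K\<^sup>2 * (norm ?dv)\<^sup>2)"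
      using gamma_pos by (intro mult_left_mono) auto
    also have "\<dots> \<le> (?t\<^sup>2 / \<beta> - Lg2) / 2 * (norm ?dv)\<^sup>2"
      using mult_right_mono[OF step_size[of "k + 1"], of "(norm ?dv)\<^sup>2"] by (simp add: algebra_simps)
    finally have dv_terms: "\<gamma> * ?t\<^sup>2 / 2 * (norm (B *v ?dv))\<^sup>2 \<le> (?t\<^sup>2 / \<beta> - Lg2) / 2 * (norm ?dv)\<^sup>2" .
    have v_terms: "(t (k + 1 + 1))\<^sup>2 / (2 * \<beta>) * (norm (v (k + 1) - ystar))\<^sup>2
        \<le> (?t\<^sup>2 + \<beta> * \<mu>g * ?t) / (2 * \<beta>) * (norm (v (k + 1) - ystar))\<^sup>2"
      using t_growth2[of "k + 1"] beta_pos by (intro mult_right_mono divide_right_mono) auto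
    have gap: "(?t\<^sup>2 - ?t) * \<Delta> k \<le> (t k)\<^sup>2 * \<Delta> k"
      using t_growth1[OF k] \<Delta>_nonneg[OF k] by (intro mult_right_mono) auto
    from arg_cong[OF constraint_v[OF k], of "inner lamstar"] have "?t * (lamstar \<bullet> (B *v v (k + 1) - b))
        = ?t\<^sup>2 * (lamstar \<bullet> r (k + 1)) - (?t\<^sup>2 - ?t) * (lamstar \<bullet> r k)"
      unfolding inner_diff_right inner_scaleR_right by simp
    then have "?t\<^sup>2 * \<Delta> (k + 1) - (?t\<^sup>2 - ?t) * \<Delta> k
      = ?t\<^sup>2 * (G (y (k + 1)) - G ystar) - (?t\<^sup>2 - ?t) * (G (y k) - G ystar)
        + ?t * (lamstar \<bullet> (B *v v (k + 1) - b))"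
      unfolding \<Delta>_def by (simp add: algebra_simps)
    also have "\<dots> = ?t\<^sup>2 * (G (y (k + 1)) - G ystar) - (?t\<^sup>2 - ?t) * (G (y k) - G ystar)
        + ?t * (lambar k \<bullet> (B *v v (k + 1) - b)) + ?t * ((lamstar - lambar k) \<bullet> (B *v v (k + 1) - b))"
      by (simp add: inner_diff_left right_diff_distrib)
    finally show ?thesis
      using primal dual dv_terms v_terms gap unfolding E_def by linarith
  qed
  have E_le: "E k \<le> E 1" if "k \<ge> 1" for k
    using that by (induction k rule: dec_induct) (use E_step in force)+
  have \<Delta>_le: "(t k)\<^sup>2 * \<Delta> k \<le> E 1"
    and lam_sq: "1 / (2 * \<gamma>) * (norm (lam k - lamstar))\<^sup>2 \<le> E 1" if k: "k \<ge> 1" for k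
  proof -
    have "(t k)\<^sup>2 * \<Delta> k \<ge> 0" "(t (k + 1))\<^sup>2 / (2 * \<beta>) * (norm (v k - ystar))\<^sup>2 \<ge> 0"
      "1 / (2 * \<gamma>) * (norm (lam k - lamstar))\<^sup>2 \<ge> 0"
      using \<Delta>_nonneg[OF k] beta_pos gamma_pos by auto
    then show "(t k)\<^sup>2 * \<Delta> k \<le> E 1" "1 / (2 * \<gamma>) * (norm (lam k - lamstar))\<^sup>2 \<le> E 1"
      using E_le[OF k] unfolding E_def[of k] by linarith+
  qed
  have lam_le: "norm (lam k - lamstar) \<le> sqrt (2 * \<gamma> * E 1)" if "k \<ge> 1" for k
    using lam_sq[OF that] gamma_pos by (intro real_le_rsqrt) (simp add: field_simps)

  define C where "C = (t 1)\<^sup>2 * norm (r 1) + (norm (lam 1 - lamstar) + sqrt (2 * \<gamma> * E 1)) / \<gamma>"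
  define a where "a k = (t (k + 1))\<^sup>2 *\<^sub>R r (k + 1)" for k
  define d where "d k = ((t (k + 1))\<^sup>2 - (t (k + 2))\<^sup>2 + t (k + 2)) / (t (k + 1))\<^sup>2" for k
  have telescope: "a k + (\<Sum>i<k. d i *\<^sub>R a i) = a 0 + (1 / \<gamma>) *\<^sub>R (lam (k + 1) - lam 1)" for k
  proof (induction k)
    case (Suc k)
    have "(1 / \<gamma>) *\<^sub>R (lam (k + 2) - lam (k + 1)) = t (k + 2) *\<^sub>R (B *v v (k + 2) - b)"
      using lam_next[of "k + 1"] gamma_pos by simp
    also have "\<dots> = (t (k + 2))\<^sup>2 *\<^sub>R r (k + 2) - ((t (k + 2))\<^sup>2 - t (k + 2)) *\<^sub>R r (k + 1)"
      using constraint_v[of "k + 1"] by simp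
    also have "((t (k + 2))\<^sup>2 - t (k + 2)) *\<^sub>R r (k + 1) = (1 - d k) *\<^sub>R a k"
    proof -
      have "(t (k + 2))\<^sup>2 - t (k + 2) = (1 - d k) * (t (k + 1))\<^sup>2"
        using t_pos[of "k + 1"] unfolding d_def by (simp add: field_simps)
      then show ?thesis unfolding a_def by simp
    qed
    also have "(t (k + 2))\<^sup>2 *\<^sub>R r (k + 2) - (1 - d k) *\<^sub>R a k = a (k + 1) - a k + d k *\<^sub>R a k"
      unfolding a_def by (simp add: algebra_simps)
    finally have "a (Suc k) + d k *\<^sub>R a k = a k + (1 / \<gamma>) *\<^sub>R (lam (k + 2) - lam (k + 1))"
      by (simp add: algebra_simps)
    then have "a (Suc k) + (\<Sum>i<Suc k. d i *\<^sub>R a i)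
        = a k + (\<Sum>i<k. d i *\<^sub>R a i) + (1 / \<gamma>) *\<^sub>R (lam (k + 2) - lam (k + 1))"
      by (simp add: algebra_simps)
    then show ?case unfolding Suc by (simp add: algebra_simps)
  qed simp
  have a_le: "norm (a k) \<le> 2 * C" for k
  proof (rule norm_le_if_weighted_sums_bounded)
    show "0 \<le> d i" for i
      using t_growth1[of "i + 1"] unfolding d_def by (intro divide_nonneg_nonneg) auto
    show "d i \<le> 1" for i
    proof -
      have "t (i + 2) \<le> (t (i + 2))\<^sup>2" using t_ge_1[of "i + 2"] by (simp add: power2_eq_square)
      then show ?thesis using t_pos[of "i + 1"] unfolding d_def by (simp add: field_simps)
    qed
    show "norm (a k + (\<Sum>i<k. d i *\<^sub>R a i)) \<le> C" for k
    proof -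
      have "norm (lam (k + 1) - lam 1) \<le> norm (lam 1 - lamstar) + sqrt (2 * \<gamma> * E 1)"
        using lam_le[of "k + 1"] norm_triangle_ineq4[of "lam (k + 1) - lamstar" "lam 1 - lamstar"]
        by simp
      then have "norm ((1 / \<gamma>) *\<^sub>R (lam (k + 1) - lam 1)) \<le> (norm (lam 1 - lamstar) + sqrt (2 * \<gamma> * E 1)) / \<gamma>"
        using gamma_pos by (simp add: divide_right_mono)
      moreover have "norm (a 0) = (t 1)\<^sup>2 * norm (r 1)" by (simp add: a_def)
      ultimately show ?thesis
        unfolding telescope C_def by (intro order_trans[OF norm_triangle_ineq]) simp
    qed
  qed
  define C4 where "C4 = 3 * (t 1)\<^sup>2 * norm (r 1)
    + (2 * norm (lam 1 - lamstar) + 2 * sqrt (2 * \<gamma> * E 1)) / \<gamma>"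
  have "2 * C \<le> C4"
    unfolding C_def C4_def by (simp add: add_divide_distrib distrib_left)
  have r_le: "norm (r k) \<le> C4 / (t k)\<^sup>2" if k: "k \<ge> 1" for k
    using a_le[of "k - 1"] \<open>2 * C \<le> C4\<close> k t_pos[OF k] by (simp add: a_def field_simps)
  have g_le: "\<bar>g (y k) - g ystar\<bar> \<le> ereal ((E 1 + C4 * norm lamstar) / (t k)\<^sup>2)" if k: "k \<ge> 1" for k
  proof -
    have "G (y k) - G ystar = \<Delta> k - lamstar \<bullet> r k" by (simp add: \<Delta>_def)
    moreover have "\<bar>lamstar \<bullet> r k\<bar> \<le> norm lamstar * (C4 / (t k)\<^sup>2)"
      using Cauchy_Schwarz_ineq2 r_le[OF k] by (meson mult_left_mono norm_ge_zero order_trans)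
    moreover have "\<Delta> k \<le> E 1 / (t k)\<^sup>2"
      using \<Delta>_le[OF k] t_pos[OF k] by (simp add: field_simps)
    ultimately have "\<bar>G (y k) - G ystar\<bar> \<le> (E 1 + C4 * norm lamstar) / (t k)\<^sup>2"
      using \<Delta>_nonneg[OF k] by (simp add: add_divide_distrib mult.commute)
    then show ?thesis by (simp add: g_eq[OF fin[OF k]] g_eq[OF sp(1)])
  qed
  have E1: "E 1 = (t 1)\<^sup>2 * (real_of_ereal (g (y 1)) - real_of_ereal (g ystar) + lamstar \<bullet> (B *v y 1 - b))
      + (t 2)\<^sup>2 / (2 * \<beta>) * (norm (y 1 - ystar))\<^sup>2 + 1 / (2 * \<gamma>) * (norm (lam 1 - lamstar))\<^sup>2"
    unfolding E_def \<Delta>_def G_def r_def using y0 by (simp add: numeral_2_eq_2)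
  show ?thesis
    unfolding Let_def E1[symmetric] using r_le g_le unfolding C4_def r_def by blast
qed

end
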